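(* Let $A_1,A_2,A_3$ be three different points of $\mathbf{Sol}$, and let $\omega_i$ ($i\in\{1,2,3\}$) be the interior angle at $A_i$ of the translation triangle $A_1A_2A_3$. Then $$\omega_1+\omega_2+\omega_3\ \ge\ \pi .$$
   Context: $\mathbf{Sol}$ is the Lie group with underlying set $\mathbb{R}^3$ (coordinates $(x,y,z)$) and multiplication $(a,b,c)(x,y,z)=(x+ae^{-z},\,y+be^{z},\,z+c)$, equipped with the Riemannian metric $(ds)^2=e^{2z}(dx)^2+e^{-2z}(dy)^2+(dz)^2$. The origin is $E_0=(0,0,0)$ (in homogeneous coordinates $(1,0,0,0)$). Translations: for a point $P=(x,y,z)$, the translation $\mathbf{T}_P$ is the map $(a,b,c)\mapsto (a,b,c)(x,y,z)=(x+ae^{-z},\,y+be^{z},\,z+c)$. It maps $E_0$ to $P$ and is an isometry of the metric. Translation curves: a translation curve starting at the origin with unit initial tangent vector $(u,v,w)$ is the solution of $\dot x(t)=u e^{-z(t)}$, $\dot y(t)=v e^{z(t)}$, $\dot z(t)=w$ with $x(0)=y(0)=z(0)=0$. That is, $x(t)=-\frac{u}{w}(e^{-wt}-1)$, $y(t)=\frac{v}{w}(e^{wt}-1)$, $z(t)=wt$ if $w\neq 0$, and $x(t)=ut$, $y(t)=vt$, $z(t)=0$ if $w=0$. Translation curves starting at another point $P$ are the images under $\mathbf{T}_P$ of translation curves starting at the origin. For different points $P,Q$, the oriented translation curve segment $t(P,Q)$ from $P$ to $Q$ is the image under $\mathbf{T}_P$ of the translation curve segment starting at $E_0$ and ending (at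 a parameter $t>0$) at $\mathbf{T}_P^{-1}(Q)$. Translation triangle: the figure consisting of three different points $A_1,A_2,A_3$ (the vertices) together with the translation curve segments connecting them pairwise (the sides). The interior angle $\omega_i\in[0,\pi]$ at $A_i$ is the angle, measured at $A_i$ by the Riemannian metric $g=e^{2z}(dx)^2+e^{-2z}(dy)^2+(dz)^2$ (via $\cos\omega=\frac{g(\mathbf u,\mathbf v)}{\sqrt{g(\mathbf u,\mathbf u)\,g(\mathbf v,\mathbf v)}}$), between the initial tangent vectors $\mathbf u,\mathbf v$ at $A_i$ of the oriented translation curve segments $t(A_i,A_j)$ and $t(A_i,A_k)$, where $\{i,j,k\}=\{1,2,3\}$. *)

theory Defs
  imports "HOL-Analysis.Analysis"
begin

text \<open>
  Points of \<open>Sol\<close> and tangent vectors are both triples of coordinates \<open>(x, y, z)\<close>;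
  a tangent vector \<open>(a, b, c)\<close> stands for \<open>a \<partial>\<^sub>x + b \<partial>\<^sub>y + c \<partial>\<^sub>z\<close> at its base point.
\<close>

type_synonym sol = "real \<times> real \<times> real"

definition sol_origin :: sol where
  "sol_origin = (0, 0, 0)"

definition sol_mult :: "sol \<Rightarrow> sol \<Rightarrow> sol" where
  "sol_mult = (\<lambda>(a, b, c) (x, y, z). (x + a * exp (- z), y + b * exp z, z + c))"

text \<open>The first argument is the base point: \<open>e\<^bsup>2z\<^esup> dx\<^sup>2 + e\<^bsup>-2z\<^esup> dy\<^sup>2 + dz\<^sup>2\<close>, polarized.\<close>

definition sol_metric :: "sol \<Rightarrow> sol \<Rightarrow> sol \<Rightarrow> real" where
  "sol_metric = (\<lambda>(x, y, z) (a, b, c) (a', b', c').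
     exp (2 * z) * (a * a') + exp (- 2 * z) * (b * b') + c * c')"

text \<open>The translation taking the origin to \<open>P\<close> multiplies by \<open>P\<close> on the right.\<close>

definition sol_translation :: "sol \<Rightarrow> sol \<Rightarrow> sol" where
  "sol_translation P Q = sol_mult Q P"

definition origin_translation_curve :: "(real \<Rightarrow> sol) \<Rightarrow> bool" where
  "origin_translation_curve \<gamma> \<longleftrightarrow>
     (\<exists>u v w. sol_metric sol_origin (u, v, w) (u, v, w) = 1 \<and>
        \<gamma> 0 = sol_origin \<and>
        (\<forall>t. case \<gamma> t of (x, y, z) \<Rightarrow>
           (\<gamma> has_vector_derivative (u * exp (- z), v * exp z, w)) (at t)))"

text \<open>
  \<open>translation_segment P Q c s\<close>: the restriction of \<open>c\<close> to \<open>{0..s}\<close> parametrizes the oriented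
  segment \<open>t(P, Q)\<close> by arc length.
\<close>

definition translation_segment :: "sol \<Rightarrow> sol \<Rightarrow> (real \<Rightarrow> sol) \<Rightarrow> real \<Rightarrow> bool" where
  "translation_segment P Q c s \<longleftrightarrow>
     (\<exists>\<gamma>. origin_translation_curve \<gamma> \<and> s > 0 \<and> \<gamma> s = inv (sol_translation P) Q \<and>
        c = sol_translation P \<circ> \<gamma>)"

text \<open>
  For \<open>P \<noteq> Q\<close> the description below is satisfied by exactly one vector, since there is exactly
  one translation curve segment from \<open>P\<close> to \<open>Q\<close>; for \<open>P = Q\<close> the value is irrelevant.
\<close>

definition initial_tangent :: "sol \<Rightarrow> sol \<Rightarrow> sol" where
  "initial_tangent P Q =
     (THE V. \<exists>c s. translation_segment P Q c s \<and> (c has_vector_derivative V) (at 0))"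

definition sol_angle :: "sol \<Rightarrow> sol \<Rightarrow> sol \<Rightarrow> real" where
  "sol_angle P U V =
     arccos (sol_metric P U V / sqrt (sol_metric P U U * sol_metric P V V))"

text \<open>The interior angle at the first argument.\<close>

definition interior_angle :: "sol \<Rightarrow> sol \<Rightarrow> sol \<Rightarrow> real" where
  "interior_angle A B C = sol_angle A (initial_tangent A B) (initial_tangent A C)"

end

theory Submission
  imports Defs
begin

text \<open>
  Right translations are isometries, so pushing a fixed orthonormal basis from the origin to every
  point yields a global orthonormal frame.  The defining equation of a translation curve says that
  its velocity has constant coordinates \<open>(u, v, w)\<close> in this frame.  Consequently every pair of
  distinct points \<open>P\<close>, \<open>Q\<close> determines one unit vector \<open>e\<^bsub>PQ\<^esub>\<close> of Euclidean \<open>\<real>\<^sup>3\<close>, the frame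
  coordinates of the direction from \<open>P\<close> to \<open>Q\<close>.  The segment from \<open>Q\<close> to \<open>P\<close> is the same curve
  run backwards, whence \<open>e\<^bsub>QP\<^esub> = - e\<^bsub>PQ\<^esub>\<close> (lemma \<open>frame_direction_swap\<close>), and interior angles
  are Euclidean angles between such vectors, even though they sit at different points
  (lemma \<open>interior_angle_eq\<close>).

  Writing \<open>\<angle>\<close> for the Euclidean angle, the three interior angles of \<open>A\<^sub>1A\<^sub>2A\<^sub>3\<close> are
  \<open>\<angle>(e\<^sub>1\<^sub>2, e\<^sub>1\<^sub>3)\<close>, \<open>\<angle>(-e\<^sub>1\<^sub>2, e\<^sub>2\<^sub>3)\<close> and \<open>\<angle>(-e\<^sub>1\<^sub>3, -e\<^sub>2\<^sub>3) = \<angle>(e\<^sub>1\<^sub>3, e\<^sub>2\<^sub>3)\<close>.  They are the lengths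
  of the arcs of a path on the unit sphere from \<open>e\<^sub>1\<^sub>2\<close> through \<open>e\<^sub>1\<^sub>3\<close> and \<open>e\<^sub>2\<^sub>3\<close> to the antipodal
  point \<open>-e\<^sub>1\<^sub>2\<close>, so by the spherical triangle inequality (lemma \<open>arccos_inner_triangle\<close>) they add
  up to at least \<open>\<pi>\<close>.
\<close>

section \<open>The spherical triangle inequality\<close>

text \<open>
  If the two angles add up to less than \<open>\<pi>\<close>, it suffices to compare cosines.  By the addition
  theorem the claim is then the Cauchy--Schwarz inequality for the components of \<open>p\<close> and \<open>r\<close>
  orthogonal to \<open>q\<close>, whose norms are the sines of the two angles.
\<close>

lemma arccos_inner_triangle:
  fixes p q r :: "'a::real_inner"
  assumes "norm p = 1" "norm q = 1" "norm r = 1"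
  shows "arccos (p \<bullet> r) \<le> arccos (p \<bullet> q) + arccos (q \<bullet> r)"
proof -
  have bound: "\<bar>a \<bullet> b\<bar> \<le> 1" if "norm a = 1" "norm b = 1" for a b :: 'a
    using Cauchy_Schwarz_ineq2[of a b] that by simp
  have unit: "p \<bullet> p = 1" "q \<bullet> q = 1" "r \<bullet> r = 1"
    using assms by (simp_all add: dot_square_norm)
  have pq: "\<bar>p \<bullet> q\<bar> \<le> 1" and qr: "\<bar>q \<bullet> r\<bar> \<le> 1" and pr: "\<bar>p \<bullet> r\<bar> \<le> 1"
    using bound assms by auto
  let ?a = "arccos (p \<bullet> q)" and ?b = "arccos (q \<bullet> r)"
  show ?thesis
  proof (cases "?a + ?b \<le> pi")
    case False
    then show ?thesis using arccos_ubound[of "p \<bullet> r"] pr by linarith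
  next
    case True
    define p' where "p' = p - (p \<bullet> q) *\<^sub>R q"
    define r' where "r' = r - (q \<bullet> r) *\<^sub>R q"
    have "p' \<bullet> p' = 1 - (p \<bullet> q)\<^sup>2"
      by (simp add: p'_def inner_diff inner_commute unit power2_eq_square algebra_simps)
    then have np: "norm p' = sqrt (1 - (p \<bullet> q)\<^sup>2)" by (simp add: norm_eq_sqrt_inner)
    have "r' \<bullet> r' = 1 - (q \<bullet> r)\<^sup>2"
      by (simp add: r'_def inner_diff inner_commute unit power2_eq_square algebra_simps)
    then have nr: "norm r' = sqrt (1 - (q \<bullet> r)\<^sup>2)" by (simp add: norm_eq_sqrt_inner)
    have "p' \<bullet> r' = p \<bullet> r - (p \<bullet> q) * (q \<bullet> r)"
      by (simp add: p'_def r'_def inner_diff inner_commute unit algebra_simps)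
    moreover have "- (norm p' * norm r') \<le> p' \<bullet> r'"
      using Cauchy_Schwarz_ineq2[of p' r'] by linarith
    moreover have "cos (?a + ?b) = (p \<bullet> q) * (q \<bullet> r) - norm p' * norm r'"
      using pq qr by (simp add: cos_add sin_arccos_abs np nr)
    ultimately have "cos (?a + ?b) \<le> p \<bullet> r" by linarith
    then have "arccos (p \<bullet> r) \<le> arccos (cos (?a + ?b))"
      using pr by (intro arccos_le_mono[THEN iffD2]) auto
    also have "\<dots> = ?a + ?b"
      using True pq qr by (intro arccos_cos add_nonneg_nonneg arccos_lbound) auto
    finally show ?thesis .
  qed
qed

section \<open>Translation curves from the origin in closed form\<close>

text \<open>
  The mean of \<open>exp (- t)\<close> over the interval between \<open>0\<close> and \<open>c\<close>.  The case distinction removes the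
  singularity at \<open>0\<close> and lets the two forms of the translation curves, for \<open>w \<noteq> 0\<close> and \<open>w = 0\<close>, be
  treated together.
\<close>

definition exp_mean :: "real \<Rightarrow> real" where
  "exp_mean c = (if c = 0 then 1 else (1 - exp (- c)) / c)"

lemma exp_mean_pos: "exp_mean c > 0"
  by (auto simp: exp_mean_def zero_less_divide_iff)

lemma exp_mean_minus: "exp_mean (- c) = exp c * exp_mean c"
  by (auto simp: exp_mean_def field_simps exp_minus)

lemma exp_mean_has_derivative:
  "((\<lambda>t. t * exp_mean (w * t)) has_real_derivative exp (- (w * t))) (at t)"
proof (cases "w = 0")
  case True
  then show ?thesis by (simp add: exp_mean_def)
next
  case False
  then have "(\<lambda>t. t * exp_mean (w * t)) = (\<lambda>t. (1 - exp (- (w * t))) / w)"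
    by (auto simp: exp_mean_def fun_eq_iff)
  then show ?thesis
    using False by (auto intro!: derivative_eq_intros)
qed

text \<open>
  The endpoint at time \<open>1\<close> of the curve with initial velocity \<open>(u, v, w)\<close>, of any length: the
  exponential map of the group.  Its inverse below gives the direction of a point seen from the origin.
\<close>

definition sol_exp :: "sol \<Rightarrow> sol" where
  "sol_exp = (\<lambda>(u, v, w). (u * exp_mean w, v * exp_mean (- w), w))"

definition sol_log :: "sol \<Rightarrow> sol" where
  "sol_log = (\<lambda>(a, b, c). (a / exp_mean c, b / exp_mean (- c), c))"

lemma sol_log_exp [simp]: "sol_log (sol_exp V) = V"
  using exp_mean_pos by (auto simp: sol_log_def sol_exp_def split: prod.split)
    (metis less_irrefl)+

lemma sol_exp_log [simp]: "sol_exp (sol_log R) = R"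
  using exp_mean_pos by (auto simp: sol_log_def sol_exp_def split: prod.split)
    (metis less_irrefl)+

lemma sol_exp_eq_iff: "sol_exp V = R \<longleftrightarrow> V = sol_log R"
  by (metis sol_log_exp sol_exp_log)

text \<open>
  The right-invariant frame: \<open>frame_vector P V\<close> is the image of \<open>V\<close> under the differential at the
  origin of the translation by \<open>P\<close>.
\<close>

definition frame_vector :: "sol \<Rightarrow> sol \<Rightarrow> sol" where
  "frame_vector = (\<lambda>(x, y, z) (u, v, w). (u * exp (- z), v * exp z, w))"

lemma sol_metric_frame_vector: "sol_metric P (frame_vector P U) (frame_vector P V) = U \<bullet> V"
proof -
  have "exp (2 * z) = exp z * exp z" for z :: real by (simp flip: exp_add)
  then show ?thesis
    by (cases P; cases U; cases V)
      (simp add: sol_metric_def frame_vector_def exp_minus divide_simps, simp add: algebra_simps)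
qed

lemma sol_metric_origin: "sol_metric sol_origin U V = U \<bullet> V"
  by (cases U; cases V) (simp add: sol_metric_def sol_origin_def)

lemma frame_vector_origin [simp]: "frame_vector sol_origin V = V"
  by (cases V) (simp add: frame_vector_def sol_origin_def)

lemma origin_translation_curve_iff_frame:
  "origin_translation_curve \<gamma> \<longleftrightarrow>
     (\<exists>V. norm V = 1 \<and> \<gamma> 0 = sol_origin \<and>
        (\<forall>t. (\<gamma> has_vector_derivative frame_vector (\<gamma> t) V) (at t)))"
  by (simp add: origin_translation_curve_def frame_vector_def sol_metric_origin
      norm_eq_sqrt_inner split_beta)

lemma eq_if_same_derivative:
  fixes f g :: "real \<Rightarrow> real"
  assumes "\<And>t. (f has_real_derivative h t) (at t)" "\<And>t. (g has_real_derivative h t) (at t)"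
    and "f 0 = g 0"
  shows "f t = g t"
proof -
  have "((\<lambda>t. f t - g t) has_real_derivative 0) (at t)" for t
    using DERIV_diff[OF assms(1,2), of t] by simp
  then have "f t - g t = f 0 - g 0" by (intro DERIV_isconst_all) blast
  then show ?thesis using assms(3) by simp
qed

lemma sol_exp_line_has_derivative:
  "((\<lambda>t. sol_exp (t *\<^sub>R V)) has_vector_derivative frame_vector (sol_exp (t *\<^sub>R V)) V) (at t)"
proof -
  obtain u v w where V: "V = (u, v, w)" by (cases V)
  have "((\<lambda>t. u * (t * exp_mean (w * t))) has_real_derivative u * exp (- (w * t))) (at t)"
    by (intro DERIV_cmult exp_mean_has_derivative)
  moreover have "((\<lambda>t. v * (t * exp_mean (- w * t))) has_real_derivative v * exp (- (- w * t))) (at t)"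
    by (intro DERIV_cmult exp_mean_has_derivative)
  moreover have "((\<lambda>t. t * w) has_real_derivative w) (at t)"
    by (auto intro!: derivative_eq_intros)
  ultimately show ?thesis
    unfolding V has_real_derivative_iff_has_vector_derivative
    by (auto intro!: has_vector_derivative_Pair simp: sol_exp_def frame_vector_def mult_ac)
qed

text \<open>
  The system is triangular: the third coordinate is linear in \<open>t\<close>, and once it is known the other two
  coordinates have prescribed derivatives.
\<close>

lemma origin_curve_unique:
  assumes "\<gamma> 0 = sol_origin" and "\<And>t. (\<gamma> has_vector_derivative frame_vector (\<gamma> t) V) (at t)"
  shows "\<gamma> t = sol_exp (t *\<^sub>R V)"
proof -
  obtain u v w where V: "V = (u, v, w)" by (cases V)
  let ?\<delta> = "\<lambda>t. sol_exp (t *\<^sub>R V)"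
  have components:
    "((\<lambda>t. fst (\<eta> t)) has_real_derivative u * exp (- snd (snd (\<eta> t)))) (at t)"
    "((\<lambda>t. fst (snd (\<eta> t))) has_real_derivative v * exp (snd (snd (\<eta> t)))) (at t)"
    "((\<lambda>t. snd (snd (\<eta> t))) has_real_derivative w) (at t)"
    if "\<And>t. (\<eta> has_vector_derivative frame_vector (\<eta> t) V) (at t)" for \<eta> t
  proof -
    note d = that[of t]
    note fst = bounded_linear.has_vector_derivative[OF bounded_linear_fst]
    note snd = bounded_linear.has_vector_derivative[OF bounded_linear_snd]
    show "((\<lambda>t. fst (\<eta> t)) has_real_derivative u * exp (- snd (snd (\<eta> t)))) (at t)"
      using fst[OF d] unfolding has_real_derivative_iff_has_vector_derivative
      by (simp add: V frame_vector_def split_beta)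
    show "((\<lambda>t. fst (snd (\<eta> t))) has_real_derivative v * exp (snd (snd (\<eta> t)))) (at t)"
      using fst[OF snd[OF d]] unfolding has_real_derivative_iff_has_vector_derivative
      by (simp add: V frame_vector_def split_beta)
    show "((\<lambda>t. snd (snd (\<eta> t))) has_real_derivative w) (at t)"
      using snd[OF snd[OF d]] unfolding has_real_derivative_iff_has_vector_derivative
      by (simp add: V frame_vector_def split_beta)
  qed
  note \<gamma> = components[of \<gamma>, OF assms(2)]
  note \<delta> = components[of ?\<delta>, OF sol_exp_line_has_derivative]
  have start: "\<gamma> 0 = ?\<delta> 0"
    using assms(1) by (simp add: sol_exp_def sol_origin_def zero_prod_def)
  have z: "snd (snd (\<gamma> t)) = snd (snd (?\<delta> t))" for t
    by (rule eq_if_same_derivative[OF \<gamma>(3) \<delta>(3)]) (simp only: start)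
  have "fst (\<gamma> t) = fst (?\<delta> t)"
    by (rule eq_if_same_derivative[OF \<gamma>(1)[unfolded z] \<delta>(1)]) (simp only: start)
  moreover have "fst (snd (\<gamma> t)) = fst (snd (?\<delta> t))"
    by (rule eq_if_same_derivative[OF \<gamma>(2)[unfolded z] \<delta>(2)]) (simp only: start)
  ultimately show ?thesis
    using z[of t] by (simp add: prod_eq_iff)
qed

lemma origin_translation_curve_iff:
  "origin_translation_curve \<gamma> \<longleftrightarrow> (\<exists>V. norm V = 1 \<and> \<gamma> = (\<lambda>t. sol_exp (t *\<^sub>R V)))"
proof
  assume "origin_translation_curve \<gamma>"
  then show "\<exists>V. norm V = 1 \<and> \<gamma> = (\<lambda>t. sol_exp (t *\<^sub>R V))"
    unfolding origin_translation_curve_iff_frame using origin_curve_unique by blast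
next
  assume "\<exists>V. norm V = 1 \<and> \<gamma> = (\<lambda>t. sol_exp (t *\<^sub>R V))"
  moreover have "sol_exp 0 = sol_origin"
    by (simp add: sol_exp_def sol_origin_def zero_prod_def)
  ultimately show "origin_translation_curve \<gamma>"
    unfolding origin_translation_curve_iff_frame using sol_exp_line_has_derivative
    by (auto simp del: split_paired_Ex scaleR_Pair)
qed

section \<open>The direction of one point seen from another\<close>

text \<open>The point \<open>Q P\<^sup>-\<^sup>1\<close>, which the translation by \<open>P\<close> takes to \<open>Q\<close>.\<close>

definition relative_position :: "sol \<Rightarrow> sol \<Rightarrow> sol" where
  "relative_position =
     (\<lambda>(x, y, z) (x', y', z'). ((x' - x) * exp z, (y' - y) * exp (- z), z' - z))"

lemma inv_sol_translation: "inv (sol_translation P) = relative_position P"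
proof (rule inv_unique_comp)
  show "sol_translation P \<circ> relative_position P = id"
    by (cases P) (simp add: fun_eq_iff sol_translation_def sol_mult_def relative_position_def
        mult.assoc flip: exp_add)
  show "relative_position P \<circ> sol_translation P = id"
    by (cases P) (simp add: fun_eq_iff sol_translation_def sol_mult_def relative_position_def
        mult.assoc flip: exp_add)
qed

definition frame_direction :: "sol \<Rightarrow> sol \<Rightarrow> sol" where
  "frame_direction P Q = sgn (sol_log (relative_position P Q))"

lemma sol_log_relative_position_nonzero:
  assumes "P \<noteq> Q"
  shows "sol_log (relative_position P Q) \<noteq> 0"
  using assms exp_mean_pos[THEN less_imp_neq]
  by (cases P; cases Q)
    (auto simp: sol_log_def relative_position_def zero_prod_def dest: not_sym)

lemma norm_frame_direction: "P \<noteq> Q \<Longrightarrow> norm (frame_direction P Q) = 1"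
  by (simp add: frame_direction_def norm_sgn sol_log_relative_position_nonzero)

text \<open>
  Going backwards along the curve reverses its constant frame velocity; in formulas, the factors
  \<open>exp z\<close> and \<open>exp z'\<close> are absorbed by \<open>exp_mean_minus\<close>.
\<close>

lemma frame_direction_swap: "frame_direction Q P = - frame_direction P Q"
proof -
  obtain x y z x' y' z' where PQ: "P = (x, y, z)" "Q = (x', y', z')" by (cases P; cases Q)
  have means: "exp_mean (z - z') = exp z' / exp z * exp_mean (z' - z)"
    using exp_mean_minus[of "z' - z"] by (simp add: exp_diff)
  have "exp_mean (z' - z) \<noteq> 0" using exp_mean_pos[of "z' - z"] by simp
  then have "sol_log (relative_position Q P) = - sol_log (relative_position P Q)"
    by (simp add: PQ sol_log_def relative_position_def means exp_minus divide_simps)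
      (simp add: algebra_simps)
  then show ?thesis by (simp add: frame_direction_def sgn_minus)
qed

lemma sol_translation_curve_has_derivative:
  "((sol_translation P \<circ> (\<lambda>t. sol_exp (t *\<^sub>R V))) has_vector_derivative frame_vector P V) (at 0)"
proof -
  obtain x y z where P: "P = (x, y, z)" by (cases P)
  let ?L = "\<lambda>V. frame_vector P V"
  have "linear ?L"
    by (rule linearI) (auto simp: P frame_vector_def algebra_simps)
  then have "bounded_linear ?L" by (rule linear_conv_bounded_linear[THEN iffD1])
  then have "((\<lambda>t. ?L (sol_exp (t *\<^sub>R V))) has_vector_derivative ?L V) (at 0)"
    using bounded_linear.has_vector_derivative sol_exp_line_has_derivative[of V 0]
    by (force simp: sol_exp_def frame_vector_def zero_prod_def)
  then have "((\<lambda>t. P + ?L (sol_exp (t *\<^sub>R V))) has_vector_derivative ?L V) (at 0)"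
    by (auto intro!: derivative_eq_intros)
  moreover have "sol_translation P \<circ> (\<lambda>t. sol_exp (t *\<^sub>R V)) = (\<lambda>t. P + ?L (sol_exp (t *\<^sub>R V)))"
    by (auto simp: fun_eq_iff P sol_translation_def sol_mult_def frame_vector_def split: prod.split)
  ultimately show ?thesis by simp
qed

text \<open>
  A segment with unit frame velocity \<open>V\<close> reaches \<open>Q\<close> at time \<open>s\<close> exactly if
  \<open>s V = log (Q P\<^sup>-\<^sup>1)\<close>, which determines \<open>s\<close> as the norm of the right-hand side and \<open>V\<close> as its
  direction.
\<close>

lemma initial_tangent_eq:
  assumes "P \<noteq> Q"
  shows "initial_tangent P Q = frame_vector P (frame_direction P Q)"
proof -
  let ?R = "relative_position P Q"
  have reach: "translation_segment P Q c s \<longleftrightarrow>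
      (\<exists>V. norm V = 1 \<and> s > 0 \<and> s *\<^sub>R V = sol_log ?R \<and>
         c = sol_translation P \<circ> (\<lambda>t. sol_exp (t *\<^sub>R V)))" for c s
    unfolding translation_segment_def origin_translation_curve_iff inv_sol_translation
    by (auto simp: sol_exp_eq_iff simp del: split_paired_Ex scaleR_Pair)
  show ?thesis
    unfolding initial_tangent_def
  proof (rule the_equality)
    have "norm (sol_log ?R) *\<^sub>R frame_direction P Q = sol_log ?R"
      by (simp add: frame_direction_def sgn_div_norm sol_log_relative_position_nonzero[OF assms])
    then show "\<exists>c s. translation_segment P Q c s \<and>
        (c has_vector_derivative frame_vector P (frame_direction P Q)) (at 0)"
      unfolding reach
      using sol_translation_curve_has_derivative[of P "frame_direction P Q"]
        norm_frame_direction[OF assms] sol_log_relative_position_nonzero[OF assms]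
      by (intro exI[of _ "sol_translation P \<circ> (\<lambda>t. sol_exp (t *\<^sub>R frame_direction P Q))"]
          exI[of _ "norm (sol_log ?R)"] conjI exI[of _ "frame_direction P Q"])
        (simp_all only: zero_less_norm_iff not_False_eq_True)
  next
    fix W assume "\<exists>c s. translation_segment P Q c s \<and> (c has_vector_derivative W) (at 0)"
    then obtain c s V where V: "norm V = 1" "s > 0" "s *\<^sub>R V = sol_log ?R"
        "c = sol_translation P \<circ> (\<lambda>t. sol_exp (t *\<^sub>R V))"
      and W: "(c has_vector_derivative W) (at 0)"
      unfolding reach by blast
    have "frame_direction P Q = V"
      using V(1,2) by (simp add: frame_direction_def V(3)[symmetric] sgn_scaleR sgn_div_norm)
    moreover have "W = frame_vector P V"
      using W sol_translation_curve_has_derivative[of P V] vector_derivative_unique_at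
      unfolding V(4) by blast
    ultimately show "W = frame_vector P (frame_direction P Q)" by simp
  qed
qed

section \<open>The angle sum\<close>

text \<open>
  The frame is orthonormal at every point, so the base point drops out of the angle.  This is what
  makes angles at different vertices comparable.
\<close>

lemma interior_angle_eq:
  assumes "A \<noteq> B" "A \<noteq> C"
  shows "interior_angle A B C = arccos (frame_direction A B \<bullet> frame_direction A C)"
  using norm_frame_direction[OF assms(1)] norm_frame_direction[OF assms(2)]
  by (simp add: interior_angle_def sol_angle_def initial_tangent_eq assms sol_metric_frame_vector
      dot_square_norm)

theorem theorem3p2:
  fixes A\<^sub>1 A\<^sub>2 A\<^sub>3 :: sol
  assumes "A\<^sub>1 \<noteq> A\<^sub>2" and "A\<^sub>2 \<noteq> A\<^sub>3" and "A\<^sub>1 \<noteq> A\<^sub>3"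
  shows "interior_angle A\<^sub>1 A\<^sub>2 A\<^sub>3 + interior_angle A\<^sub>2 A\<^sub>1 A\<^sub>3 + interior_angle A\<^sub>3 A\<^sub>1 A\<^sub>2 \<ge> pi"
proof -
  define p where "p = frame_direction A\<^sub>1 A\<^sub>2"
  define q where "q = frame_direction A\<^sub>1 A\<^sub>3"
  define r where "r = frame_direction A\<^sub>2 A\<^sub>3"
  have unit: "norm p = 1" "norm q = 1" "norm r = 1"
    using assms norm_frame_direction by (auto simp: p_def q_def r_def)
  have angles: "interior_angle A\<^sub>1 A\<^sub>2 A\<^sub>3 = arccos (p \<bullet> q)"
    "interior_angle A\<^sub>2 A\<^sub>1 A\<^sub>3 = arccos (- (p \<bullet> r))"
    "interior_angle A\<^sub>3 A\<^sub>1 A\<^sub>2 = arccos (q \<bullet> r)"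
    using assms frame_direction_swap[of A\<^sub>2 A\<^sub>1] frame_direction_swap[of A\<^sub>3 A\<^sub>1]
      frame_direction_swap[of A\<^sub>3 A\<^sub>2]
    by (simp_all add: interior_angle_eq p_def q_def r_def)
  have "\<bar>p \<bullet> r\<bar> \<le> 1"
    using Cauchy_Schwarz_ineq2[of p r] unit by simp
  then have "arccos (- (p \<bullet> r)) = pi - arccos (p \<bullet> r)"
    by (intro arccos_minus) auto
  moreover have "arccos (p \<bullet> r) \<le> arccos (p \<bullet> q) + arccos (q \<bullet> r)"
    using unit by (rule arccos_inner_triangle)
  ultimately show ?thesis
    unfolding angles by linarith
qed

end
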